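(* For all $n\geq 0$, $$\mathrm{pspa}'(2n+1)+\mathrm{pspa}'(4n+1)+\mathrm{pspa}'(8n+1)\equiv \mathrm{spa}'(2n+1)\pmod 2.$$
   Context: The modified semi-Padovan sequence $\{\mathrm{spa}'(n)\}_{n\ge0}$ is defined by $\mathrm{spa}'(0)=0$, $\mathrm{spa}'(1)=1$, and for $n\ge1$: $\mathrm{spa}'(2n)=\mathrm{spa}'(n)$ and $\mathrm{spa}'(2n+1)=\mathrm{spa}'(2n-1)+\mathrm{spa}'(2n-2)$. For $n\ge1$, $\mathrm{pspa}'(n)$ denotes the total number of parts (counted with multiplicity) in all the partitions in $\mathcal{SP}a'(n)$, the set of modified semi-Padovan partitions of $n$, defined as follows. A partition of $n$ is a weakly decreasing sequence (equivalently, a finite multiset) of positive integers with sum $n$. $\lambda\sqcup\mu$ is the partition whose multiset of parts is the multiset union (multiplicities added) of the parts of $\lambda$ and $\mu$; $2\lambda$ is obtained by doubling every part; if $\lambda$ has an odd part, $\lambda^{o+2}$ is obtained by adding $2$ to (one occurrence of) the largest odd part of $\lambda$. These operations are applied elementwise to sets of partitions (giving $\emptyset$ for the empty set). Then $\mathcal{SP}a'(0)=\emptyset$, $\mathcal{SP}a'(1)=\{(1)\}$, and for $n\ge1$: $\mathcal{SP}a'(2n)=2\,\mathcal{SP}a'(n)$ and $\mathcal{SP}a'(2n+1)=\mathcal{SP}a'(2n-1)^{o+2}\cup\big(\mathcal{SP}a'(2n-2)\sqcup(1,1,1)\big)$. *)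

theory Defs
  imports "HOL-Library.Multiset" "HOL-Number_Theory.Cong"
begin

text \<open>The modified semi-Padovan sequence. For odd \<open>n = 2 * m + 1 \<ge> 3\<close> the indices
  \<open>2 * m - 1\<close> and \<open>2 * m - 2\<close> are \<open>n - 2\<close> and \<open>n - 3\<close>.\<close>

fun spa' :: "nat \<Rightarrow> nat" where
  "spa' n =
     (if n = 0 then 0
      else if n = 1 then 1
      else if even n then spa' (n div 2)
      else spa' (n - 2) + spa' (n - 3))"

declare spa'.simps [simp del]

text \<open>A partition is represented by the finite multiset of its parts, so that \<open>\<pi> \<squnion> \<mu>\<close> is
  multiset addition.\<close>

definition double_parts :: "nat multiset \<Rightarrow> nat multiset" where
  "double_parts \<pi> = image_mset (\<lambda>k. 2 * k) \<pi>"

definition largest_odd_part :: "nat multiset \<Rightarrow> nat" where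
  "largest_odd_part \<pi> = Max {k \<in> set_mset \<pi>. odd k}"

text \<open>Adds \<open>2\<close> to one occurrence of the largest odd part. Meaningful only if \<open>\<pi>\<close> has an odd
  part (otherwise \<open>Max\<close> is taken over the empty set); below it is only applied to partitions of
  odd numbers, see \<open>SPa'_partition\<close> and \<open>largest_odd_part_in\<close>.\<close>

definition odd_plus_two :: "nat multiset \<Rightarrow> nat multiset" where
  "odd_plus_two \<pi> = \<pi> - {#largest_odd_part \<pi>#} + {#largest_odd_part \<pi> + 2#}"

fun SPa' :: "nat \<Rightarrow> nat multiset set" where
  "SPa' n =
     (if n = 0 then {}
      else if n = 1 then {{#1#}}
      else if even n then double_parts ` SPa' (n div 2)
      else odd_plus_two ` SPa' (n - 2) \<union> (\<lambda>\<mu>. \<mu> + {#1, 1, 1#}) ` SPa' (n - 3))"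

declare SPa'.simps [simp del]

definition pspa' :: "nat \<Rightarrow> nat" where
  "pspa' n = (\<Sum>\<pi>\<in>SPa' n. size \<pi>)"

lemma spa'_0: "spa' 0 = 0"
  and spa'_1: "spa' 1 = 1"
  and spa'_even: "n \<ge> 1 \<Longrightarrow> spa' (2 * n) = spa' n"
  and spa'_odd: "n \<ge> 1 \<Longrightarrow> spa' (2 * n + 1) = spa' (2 * n - 1) + spa' (2 * n - 2)"
proof -
  have idx: "2 * n + 1 - 2 = 2 * n - 1" "2 * n + 1 - 3 = 2 * n - 2" by simp_all
  show "spa' 0 = 0" "spa' 1 = 1" by (simp_all add: spa'.simps[of 0] spa'.simps[of "Suc 0"])
  show "spa' (2 * n) = spa' n" if "n \<ge> 1"
    using that by (simp add: spa'.simps[of "2 * n"])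
  show "spa' (2 * n + 1) = spa' (2 * n - 1) + spa' (2 * n - 2)" if "n \<ge> 1"
    using that spa'.simps[of "2 * n + 1", unfolded idx] by simp
qed

lemma SPa'_0: "SPa' 0 = {}"
  and SPa'_1: "SPa' 1 = {{#1#}}"
  and SPa'_even: "n \<ge> 1 \<Longrightarrow> SPa' (2 * n) = double_parts ` SPa' n"
  and SPa'_odd: "n \<ge> 1 \<Longrightarrow> SPa' (2 * n + 1) =
    odd_plus_two ` SPa' (2 * n - 1) \<union> (\<lambda>\<mu>. \<mu> + {#1, 1, 1#}) ` SPa' (2 * n - 2)"
proof -
  have idx: "2 * n + 1 - 2 = 2 * n - 1" "2 * n + 1 - 3 = 2 * n - 2" by simp_all
  show "SPa' 0 = {}" "SPa' 1 = {{#1#}}" by (simp_all add: SPa'.simps[of 0] SPa'.simps[of "Suc 0"])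
  show "SPa' (2 * n) = double_parts ` SPa' n" if "n \<ge> 1"
    using that by (simp add: SPa'.simps[of "2 * n"])
  show "SPa' (2 * n + 1) =
    odd_plus_two ` SPa' (2 * n - 1) \<union> (\<lambda>\<mu>. \<mu> + {#1, 1, 1#}) ` SPa' (2 * n - 2)" if "n \<ge> 1"
    using that SPa'.simps[of "2 * n + 1", unfolded idx] by simp
qed

text \<open>The sum defining \<open>pspa'\<close> is never a sum over an infinite set.\<close>

lemma finite_SPa': "finite (SPa' n)"
proof (induction n rule: SPa'.induct)
  case (1 n)
  then show ?case by (subst SPa'.simps) simp
qed

lemma odd_sum_mset_has_odd_part:
  "odd (sum_mset \<pi>) \<Longrightarrow> \<exists>k \<in># \<pi>. odd k" for \<pi> :: "nat multiset"
  by (induction \<pi>) auto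

lemma largest_odd_part_in:
  assumes "odd (sum_mset \<pi>)"
  shows "largest_odd_part \<pi> \<in># \<pi>" and "odd (largest_odd_part \<pi>)"
proof -
  have "{k \<in> set_mset \<pi>. odd k} \<noteq> {}"
    using odd_sum_mset_has_odd_part[OF assms] by auto
  then have "largest_odd_part \<pi> \<in> {k \<in> set_mset \<pi>. odd k}"
    unfolding largest_odd_part_def by (intro Max_in) auto
  then show "largest_odd_part \<pi> \<in># \<pi>" and "odd (largest_odd_part \<pi>)" by auto
qed

lemma SPa'_partition:
  "\<pi> \<in> SPa' n \<Longrightarrow> sum_mset \<pi> = n \<and> 0 \<notin># \<pi>"
proof (induction n arbitrary: \<pi> rule: SPa'.induct)
  case (1 n)
  consider "n = 0" | "n = 1" | "n > 1" "even n" | "n > 1" "odd n" by force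
  then show ?case
  proof cases
    case 1
    with "1.prems" show ?thesis by (simp add: SPa'_0)
  next
    case 2
    with "1.prems" show ?thesis using SPa'_1 by auto
  next
    case 3
    then obtain \<mu> where "\<mu> \<in> SPa' (n div 2)" "\<pi> = double_parts \<mu>"
      using "1.prems" by (subst (asm) SPa'.simps) auto
    moreover have "sum_mset \<mu> = n div 2 \<and> 0 \<notin># \<mu>"
      using "1.IH"(1)[of \<mu>] 3 calculation by simp
    ultimately show ?thesis
      using 3 by (auto simp: double_parts_def sum_mset_distrib_left[symmetric])
  next
    case 4
    then have n3: "n \<ge> 3" by presburger
    from 4 have "\<pi> \<in> odd_plus_two ` SPa' (n - 2) \<union> (\<lambda>\<mu>. \<mu> + {#1, 1, 1#}) ` SPa' (n - 3)"
      using "1.prems" by (subst (asm) SPa'.simps) auto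
    then consider \<mu> where "\<mu> \<in> SPa' (n - 2)" "\<pi> = odd_plus_two \<mu>"
      | \<mu> where "\<mu> \<in> SPa' (n - 3)" "\<pi> = \<mu> + {#1, 1, 1#}" by blast
    then show ?thesis
    proof cases
      case (1 \<mu>)
      have IH: "sum_mset \<mu> = n - 2" "0 \<notin># \<mu>"
        using "1.IH"(2)[of \<mu>] 1 4 by auto
      then have "odd (sum_mset \<mu>)" using 4 n3 by simp
      then obtain \<nu> where \<nu>: "\<mu> = add_mset (largest_odd_part \<mu>) \<nu>"
        using largest_odd_part_in(1) mset_add by metis
      then have "\<pi> = add_mset (largest_odd_part \<mu> + 2) \<nu>"
        using 1 unfolding odd_plus_two_def
        by (metis add_mset_remove_trivial add_mset_add_single)
      moreover have "largest_odd_part \<mu> + sum_mset \<nu> = n - 2"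
        using IH(1) by (subst (asm) \<nu>) simp
      moreover have "0 \<notin># \<nu>"
        using IH(2) by (subst (asm) \<nu>) simp
      ultimately show ?thesis using n3 by simp
    next
      case (2 \<mu>)
      then have "sum_mset \<mu> = n - 3" "0 \<notin># \<mu>"
        using "1.IH"(3)[of \<mu>] 4 by auto
      then show ?thesis using 2 n3 by simp
    qed
  qed
qed

end

theory Submission imports Defs
begin

text \<open>
  Passing from partitions to numbers loses nothing. Adding \<open>2\<close> to the largest odd part can be
  undone, since the enlarged part is again the largest odd one; and the partitions it produces have
  an odd part exceeding \<open>1\<close>, whereas a partition of an even number in \<open>SPa'\<close> has only even parts,
  so that appending \<open>1, 1, 1\<close> to it leaves \<open>1\<close> as the only odd part. Hence the union defining
  \<open>SPa' (2 * n + 3)\<close> is disjoint and its two pieces are injective images. This gives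
  \<open>spa' n = card (SPa' n)\<close> (\<open>card_SPa'\<close>), and for the number of parts (\<open>pspa'_double\<close>,
  \<open>pspa'_odd_step\<close>)
  \[ p(2n) = p(n), \qquad p(2n+3) = p(2n+1) + p(2n) + 3\,a(2n), \]
  where \<open>p = pspa'\<close> and \<open>a = spa'\<close>.

  The congruence then follows by induction on \<open>n\<close>. For \<open>n = 0\<close> it reads \<open>3 \<equiv> 1\<close>. Using
  \<open>a(2n+3) = a(2n+1) + a(2n)\<close>, the recurrences yield modulo \<open>2\<close> the increments
  \[ p(2n+3) - p(2n+1), \qquad p(4n+5) - p(4n+1) \equiv p(2n+3) + a(2n+1), \qquad
     p(8n+9) - p(8n+1) \equiv p(2n+1) + a(2n+3), \]
  the last two being \<open>pspa'_quadruple_step\<close> and \<open>pspa'_octuple_step\<close>. In their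
  sum all values of \<open>p\<close> cancel modulo \<open>2\<close>, leaving \<open>a(2n+1) + a(2n+3)\<close>, which is the increment of
  the right-hand side.
\<close>

lemma largest_odd_part_mem:
  assumes "\<exists>k \<in># \<pi>. odd k"
  shows "largest_odd_part \<pi> \<in># \<pi>" and "odd (largest_odd_part \<pi>)"
proof -
  have "largest_odd_part \<pi> \<in> {k \<in> set_mset \<pi>. odd k}"
    unfolding largest_odd_part_def using assms by (intro Max_in) auto
  then show "largest_odd_part \<pi> \<in># \<pi>" and "odd (largest_odd_part \<pi>)" by auto
qed

lemma largest_odd_part_odd_plus_two:
  assumes "\<exists>k \<in># \<pi>. odd k"
  shows "largest_odd_part (odd_plus_two \<pi>) = largest_odd_part \<pi> + 2"
proof -
  have le: "k \<le> largest_odd_part \<pi>" if "k \<in># \<pi>" "odd k" for k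
    unfolding largest_odd_part_def using that by (intro Max_ge) auto
  show ?thesis
    unfolding largest_odd_part_def[of "odd_plus_two \<pi>"]
  proof (rule Max_eqI)
    fix k assume "k \<in> {k \<in> set_mset (odd_plus_two \<pi>). odd k}"
    then have "odd k" "k \<in># \<pi> \<or> k = largest_odd_part \<pi> + 2"
      by (auto simp: odd_plus_two_def dest: in_diffD)
    then show "k \<le> largest_odd_part \<pi> + 2" using le[of k] by auto
  qed (use largest_odd_part_mem[OF assms] in \<open>auto simp: odd_plus_two_def\<close>)
qed

text \<open>The operation can be undone because the enlarged part is again the largest odd one, so the part
  to be reduced by \<open>2\<close> is recognisable.\<close>

lemma inj_on_odd_plus_two: "inj_on odd_plus_two {\<pi>. \<exists>k \<in># \<pi>. odd k}"
proof (rule inj_on_inverseI)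
  fix \<pi> :: "nat multiset"
  assume "\<pi> \<in> {\<pi>. \<exists>k \<in># \<pi>. odd k}"
  then have odd_part: "\<exists>k \<in># \<pi>. odd k" by simp
  show "odd_plus_two \<pi> - {#largest_odd_part (odd_plus_two \<pi>)#}
      + {#largest_odd_part (odd_plus_two \<pi>) - 2#} = \<pi>"
    unfolding largest_odd_part_odd_plus_two[OF odd_part]
    using largest_odd_part_mem(1)[OF odd_part] by (simp add: odd_plus_two_def)
qed

lemma size_odd_plus_two:
  assumes "\<exists>k \<in># \<pi>. odd k"
  shows "size (odd_plus_two \<pi>) = size \<pi>"
  using largest_odd_part_mem(1)[OF assms]
  by (simp add: odd_plus_two_def size_Suc_Diff1 del: size_Diff_singleton)

lemma SPa'_odd_has_odd_part:
  assumes "\<pi> \<in> SPa' n" "odd n"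
  shows "\<exists>k \<in># \<pi>. odd k"
  using assms odd_sum_mset_has_odd_part SPa'_partition by metis

lemma SPa'_even_parts:
  assumes "\<pi> \<in> SPa' (2 * n)" "k \<in># \<pi>"
  shows "even k"
  using assms by (cases "n = 0") (auto simp: SPa'_0 SPa'_even double_parts_def)

lemma SPa'_odd_step:
  "SPa' (2 * n + 3) = odd_plus_two ` SPa' (2 * n + 1) \<union> (\<lambda>\<mu>. \<mu> + {#1, 1, 1#}) ` SPa' (2 * n)"
  using SPa'_odd[of "n + 1"] by (simp add: numeral_3_eq_3)

lemma inj_double_parts: "inj double_parts"
  by (rule inj_on_inverseI[where g = "image_mset (\<lambda>k. k div 2)"])
    (simp add: double_parts_def multiset.map_comp comp_def)

text \<open>The cardinality and the total number of parts are both sums of this kind, for \<open>f\<close>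
  constantly \<open>1\<close> and \<open>f = size\<close> respectively.\<close>

lemma sum_SPa'_even:
  fixes f :: "nat multiset \<Rightarrow> nat"
  shows "(\<Sum>\<pi>\<in>SPa' (2 * n). f \<pi>) = (\<Sum>\<pi>\<in>SPa' n. f (double_parts \<pi>))"
  by (cases "n = 0")
    (simp_all add: SPa'_0 SPa'_even sum.reindex inj_on_subset[OF inj_double_parts])

text \<open>A partition cannot arise from both constructions: its largest odd part would exceed \<open>1\<close> by
  the first and equal \<open>1\<close> by the second.\<close>

lemma sum_SPa'_odd_step:
  fixes f :: "nat multiset \<Rightarrow> nat"
  shows "(\<Sum>\<pi>\<in>SPa' (2 * n + 3). f \<pi>) =
    (\<Sum>\<pi>\<in>SPa' (2 * n + 1). f (odd_plus_two \<pi>)) + (\<Sum>\<pi>\<in>SPa' (2 * n). f (\<pi> + {#1, 1, 1#}))"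
proof -
  have disjoint:
    "odd_plus_two ` SPa' (2 * n + 1) \<inter> (\<lambda>\<mu>. \<mu> + {#1, 1, 1#}) ` SPa' (2 * n) = {}"
  proof -
    have "odd_plus_two \<pi> \<noteq> \<mu> + {#1, 1, 1#}"
      if \<pi>: "\<pi> \<in> SPa' (2 * n + 1)" and \<mu>: "\<mu> \<in> SPa' (2 * n)" for \<pi> \<mu>
    proof
      assume eq: "odd_plus_two \<pi> = \<mu> + {#1, 1, 1#}"
      define k where "k = largest_odd_part \<pi> + 2"
      have "odd k"
        using largest_odd_part_mem(2) SPa'_odd_has_odd_part[OF \<pi>] by (simp add: k_def)
      moreover have "k \<in># odd_plus_two \<pi>"
        by (simp add: odd_plus_two_def k_def)
      ultimately have "k = 1"
        using SPa'_even_parts[OF \<mu>, of k] by (auto simp: eq)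
      then show False by (simp add: k_def)
    qed
    then show ?thesis by blast
  qed
  have "inj_on odd_plus_two (SPa' (2 * n + 1))"
    by (rule inj_on_subset[OF inj_on_odd_plus_two]) (auto dest: SPa'_odd_has_odd_part)
  moreover have "inj_on (\<lambda>\<mu>. \<mu> + {#1, 1, 1#}) (SPa' (2 * n))"
    by (simp add: inj_on_def)
  ultimately show ?thesis
    unfolding SPa'_odd_step
    by (simp only: sum.union_disjoint finite_imageI finite_SPa' disjoint sum.reindex comp_def)
qed

lemma spa'_odd_step: "spa' (2 * n + 3) = spa' (2 * n + 1) + spa' (2 * n)"
  using spa'_odd[of "n + 1"] by (simp add: numeral_3_eq_3)

lemma spa'_double: "spa' (2 * n) = spa' n"
  by (cases "n = 0") (simp_all add: spa'_even)

text \<open>The recursion pattern shared by \<open>spa'\<close> and \<open>SPa'\<close>, with indices shifted so that no truncated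
  subtraction occurs.\<close>

lemma semi_Padovan_induct [case_names zero one even odd]:
  assumes "P 0" "P 1" "\<And>n. n \<ge> 1 \<Longrightarrow> P n \<Longrightarrow> P (2 * n)"
    and "\<And>n. P (2 * n + 1) \<Longrightarrow> P (2 * n) \<Longrightarrow> P (2 * n + 3)"
  shows "P (n :: nat)"
proof (induction n rule: less_induct)
  case (less n)
  consider "n = 0" | "n = 1" | m where "n = 2 * m" "m \<ge> 1" | m where "n = 2 * m + 3"
  proof -
    have "n = 0 \<or> n = 1 \<or> (\<exists>m. n = 2 * m \<and> m \<ge> 1) \<or> (\<exists>m. n = 2 * m + 3)"
      by presburger
    then show thesis using that by blast
  qed
  then show ?case
    using less assms by cases auto
qed

lemma card_SPa': "card (SPa' n) = spa' n"
proof (induction n rule: semi_Padovan_induct)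
  case zero
  then show ?case by (simp add: SPa'_0 spa'_0)
next
  case one
  then show ?case by (simp add: SPa'_1[simplified] spa'_1[simplified])
next
  case (even n)
  then show ?case using sum_SPa'_even[of "\<lambda>_. 1" n] by (simp add: spa'_double)
next
  case (odd n)
  then show ?case using sum_SPa'_odd_step[of "\<lambda>_. 1" n] by (simp add: spa'_odd_step)
qed

lemma pspa'_1: "pspa' 1 = 1"
  by (simp add: pspa'_def SPa'_1[simplified])

lemma pspa'_double: "pspa' (2 * n) = pspa' n"
  unfolding pspa'_def sum_SPa'_even by (simp add: double_parts_def)

lemma pspa'_odd_step: "pspa' (2 * n + 3) = pspa' (2 * n + 1) + pspa' (2 * n) + 3 * spa' (2 * n)"
proof -
  have "(\<Sum>\<pi>\<in>SPa' (2 * n + 1). size (odd_plus_two \<pi>)) = pspa' (2 * n + 1)"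
    unfolding pspa'_def
    by (intro sum.cong size_odd_plus_two SPa'_odd_has_odd_part[of _ "2 * n + 1"]) auto
  moreover have "(\<Sum>\<pi>\<in>SPa' (2 * n). size (\<pi> + {#1, 1, 1#})) = pspa' (2 * n) + 3 * spa' (2 * n)"
    unfolding pspa'_def card_SPa'[symmetric]
    by (simp add: sum.distrib flip: numeral_3_eq_3) (simp add: sum_Suc)
  ultimately show ?thesis
    using sum_SPa'_odd_step[of size n] by (simp add: pspa'_def)
qed

lemma cong_2_iff_parity: "[a = b] (mod 2) \<longleftrightarrow> (even a \<longleftrightarrow> even b)" for a b :: nat
  unfolding cong_def by (simp add: mod2_eq_if)

lemma odd_steps_below_quadruple:
  shows "pspa' (4 * n + 5) = pspa' (4 * n + 3) + pspa' (2 * n + 1) + 3 * spa' (2 * n + 1)"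
    and "pspa' (4 * n + 3) = pspa' (4 * n + 1) + pspa' (2 * n) + 3 * spa' (2 * n)"
    and "spa' (4 * n + 3) = spa' (4 * n + 1) + spa' (2 * n)"
proof -
  have idx: "2 * (2 * n + 1) + 3 = 4 * n + 5" "2 * (2 * n + 1) + 1 = 4 * n + 3"
    "2 * (2 * n) + 3 = 4 * n + 3" "2 * (2 * n) + 1 = 4 * n + 1"
    by simp_all
  show "pspa' (4 * n + 5) = pspa' (4 * n + 3) + pspa' (2 * n + 1) + 3 * spa' (2 * n + 1)"
    using pspa'_odd_step[of "2 * n + 1"] by (simp only: idx pspa'_double spa'_double)
  show "pspa' (4 * n + 3) = pspa' (4 * n + 1) + pspa' (2 * n) + 3 * spa' (2 * n)"
    using pspa'_odd_step[of "2 * n"] by (simp only: idx pspa'_double spa'_double)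
  show "spa' (4 * n + 3) = spa' (4 * n + 1) + spa' (2 * n)"
    using spa'_odd_step[of "2 * n"] by (simp only: idx spa'_double)
qed

text \<open>Two steps of the recurrence lead from \<open>4 * n + 1\<close> to \<open>4 * n + 5\<close>. The first adds
  \<open>pspa' (2 * n) + 3 * spa' (2 * n)\<close>, which equals \<open>pspa' (2 * n + 3) - pspa' (2 * n + 1)\<close>; the
  second adds \<open>pspa' (2 * n + 1) + 3 * spa' (2 * n + 1)\<close>, so \<open>pspa' (2 * n + 1)\<close> cancels.\<close>

lemma pspa'_quadruple_step:
  "[pspa' (4 * n + 5) = pspa' (4 * n + 1) + pspa' (2 * n + 3) + spa' (2 * n + 1)] (mod 2)"
  unfolding cong_2_iff_parity odd_steps_below_quadruple(1,2) pspa'_odd_step even_add even_mult_iff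
  by auto

text \<open>Two instances of the preceding congruence lead from \<open>8 * n + 1\<close> to \<open>8 * n + 9\<close>. Modulo \<open>2\<close>
  their terms combine to \<open>pspa' (4 * n + 3) + pspa' (4 * n + 5) \<equiv> pspa' (2 * n + 1) + spa' (2 * n + 1)\<close>
  and \<open>spa' (4 * n + 1) + spa' (4 * n + 3) \<equiv> spa' (2 * n)\<close>, and the two \<open>spa'\<close> terms add up to
  \<open>spa' (2 * n + 3)\<close>.\<close>

lemma pspa'_octuple_step:
  "[pspa' (8 * n + 9) = pspa' (8 * n + 1) + pspa' (2 * n + 1) + spa' (2 * n + 3)] (mod 2)"
proof -
  have idx: "4 * (2 * n + 1) + 5 = 8 * n + 9" "4 * (2 * n + 1) + 1 = 8 * n + 5"
    "2 * (2 * n + 1) + 3 = 4 * n + 5" "2 * (2 * n + 1) + 1 = 4 * n + 3"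
    "4 * (2 * n) + 5 = 8 * n + 5" "4 * (2 * n) + 1 = 8 * n + 1"
    "2 * (2 * n) + 3 = 4 * n + 3" "2 * (2 * n) + 1 = 4 * n + 1"
    by simp_all
  have "[pspa' (8 * n + 9) = pspa' (8 * n + 5) + pspa' (4 * n + 5) + spa' (4 * n + 3)] (mod 2)"
    using pspa'_quadruple_step[of "2 * n + 1"] by (simp only: idx)
  moreover have
    "[pspa' (8 * n + 5) = pspa' (8 * n + 1) + pspa' (4 * n + 3) + spa' (4 * n + 1)] (mod 2)"
    using pspa'_quadruple_step[of "2 * n"] by (simp only: idx)
  ultimately show ?thesis
    unfolding cong_2_iff_parity odd_steps_below_quadruple(1,3) spa'_odd_step
      even_add even_mult_iff
    by auto
qed

theorem theorem5p12:
  fixes n :: nat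
  shows "[pspa' (2 * n + 1) + pspa' (4 * n + 1) + pspa' (8 * n + 1) = spa' (2 * n + 1)] (mod 2)"
proof (induction n)
  case 0
  then show ?case by (simp add: cong_def pspa'_1[simplified] spa'_1[simplified])
next
  case (Suc n)
  have idx: "2 * Suc n + 1 = 2 * n + 3" "4 * Suc n + 1 = 4 * n + 5" "8 * Suc n + 1 = 8 * n + 9"
    by simp_all
  show ?case
    unfolding idx
    using Suc pspa'_quadruple_step[of n] pspa'_octuple_step[of n]
    unfolding cong_2_iff_parity even_add by argo
qed

end
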